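(* Let $\lambda\in\mathbb{C}\setminus\{0\}$. The function $f_\lambda(z)=\lambda\tan z$ cannot have a cycle of Herman rings.
   Context: The Fatou set of $f_\lambda$ is the set of points of $\hat{\mathbb{C}}$ having a neighborhood on which all iterates of $f_\lambda$ are defined, meromorphic, and form a normal family. A cycle of Herman rings is a periodic cycle $D_0,\dots,D_{p-1}$ of components of the Fatou set such that each $D_i$ is holomorphically homeomorphic to a standard annulus $\{1<|\zeta|<R\}$ by a map conjugating the first return map $f_\lambda^{\circ p}|_{D_i}$ to an irrational rotation of the annulus. *)

theory Defs
  imports "HOL-Complex_Analysis.Complex_Analysis"
begin

section \<open>The Riemann sphere\<close>

text \<open>
  The sphere is the one-point compactification of the plane: \<^term>\<open>Some z\<close> is the finite point
  \<^term>\<open>z\<close>, and \<^term>\<open>None\<close> is the point at infinity.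
\<close>

type_synonym sphere = "complex option"

abbreviation sphere_top :: "sphere topology" where
  "sphere_top \<equiv> Alexandroff_compactification euclidean"

text \<open>The chordal metric (stereographic projection to the unit sphere).\<close>

fun chordal :: "sphere \<Rightarrow> sphere \<Rightarrow> real" where
  "chordal (Some z) (Some w) =
     2 * cmod (z - w) / (sqrt (1 + (cmod z)\<^sup>2) * sqrt (1 + (cmod w)\<^sup>2))"
| "chordal (Some z) None = 2 / sqrt (1 + (cmod z)\<^sup>2)"
| "chordal None (Some w) = 2 / sqrt (1 + (cmod w)\<^sup>2)"
| "chordal None None = 0"

text \<open>The involution \<open>z \<mapsto> 1/z\<close>.\<close>

fun sphere_inv :: "sphere \<Rightarrow> sphere" where
  "sphere_inv None = Some 0"
| "sphere_inv (Some z) = (if z = 0 then None else Some (1 / z))"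

text \<open>
  Holomorphic maps from an open subset of the sphere to the sphere: continuous maps that are
  holomorphic in the two standard charts.  Here \<open>a\<close> selects the chart (\<open>z\<close> or \<open>1/z\<close>) in the
  source and \<open>b\<close> the one in the target; by continuity the set on which a chart
  representation is required to be holomorphic is open.
\<close>

definition sphere_holomorphic_on :: "(sphere \<Rightarrow> sphere) \<Rightarrow> sphere set \<Rightarrow> bool" where
  "sphere_holomorphic_on g V \<longleftrightarrow>
     openin sphere_top V \<and>
     continuous_map (subtopology sphere_top V) sphere_top g \<and>
     (\<forall>a\<in>{id, sphere_inv}. \<forall>b\<in>{id, sphere_inv}.
        (\<lambda>z. the (b (g (a (Some z))))) holomorphic_on
          {z. a (Some z) \<in> V \<and> b (g (a (Some z))) \<noteq> None})"

text \<open>Meromorphic functions: in addition, the poles are isolated.\<close>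

definition sphere_meromorphic_on :: "(sphere \<Rightarrow> sphere) \<Rightarrow> sphere set \<Rightarrow> bool" where
  "sphere_meromorphic_on g V \<longleftrightarrow>
     sphere_holomorphic_on g V \<and>
     (\<forall>x\<in>V. \<exists>U. openin sphere_top U \<and> x \<in> U \<and> (\<forall>y\<in>U - {x}. g y \<noteq> None))"

text \<open>
  Normality in Montel's sense: every sequence in the family has a subsequence converging
  uniformly on compact subsets with respect to the chordal metric (the limit may be the
  constant infinity).
\<close>

definition normal_family_on :: "(sphere \<Rightarrow> sphere) set \<Rightarrow> sphere set \<Rightarrow> bool" where
  "normal_family_on F V \<longleftrightarrow>
     (\<forall>s :: nat \<Rightarrow> sphere \<Rightarrow> sphere. range s \<subseteq> F \<longrightarrow>
       (\<exists>(r :: nat \<Rightarrow> nat) g. strict_mono r \<and>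
          (\<forall>K. compactin sphere_top K \<and> K \<subseteq> V \<longrightarrow>
             (\<forall>e>0. \<exists>N. \<forall>n\<ge>N. \<forall>x\<in>K. chordal (s (r n) x) (g x) < e))))"


section \<open>Iteration of functions meromorphic in the plane\<close>

text \<open>
  A meromorphic function in the plane is given as a map \<^term>\<open>f :: complex \<Rightarrow> sphere\<close>; it is not
  defined at infinity.  Extending it by the dummy value \<^term>\<open>None\<close> there, the \<open>n\<close>-th iterate is
  genuinely defined exactly at the points of \<open>iterate_dom f n\<close>.
\<close>

definition iterate :: "(complex \<Rightarrow> sphere) \<Rightarrow> nat \<Rightarrow> sphere \<Rightarrow> sphere" where
  "iterate f n = ((\<lambda>x. Option.bind x f) ^^ n)"

definition iterate_dom :: "(complex \<Rightarrow> sphere) \<Rightarrow> nat \<Rightarrow> sphere set" where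
  "iterate_dom f n = {x. \<forall>k<n. iterate f k x \<noteq> None}"

definition Fatou :: "(complex \<Rightarrow> sphere) \<Rightarrow> sphere set" where
  "Fatou f = {x. \<exists>U. openin sphere_top U \<and> x \<in> U \<and>
      (\<forall>n. U \<subseteq> iterate_dom f n \<and> sphere_meromorphic_on (iterate f n) U) \<and>
      normal_family_on (range (iterate f)) U}"

definition Fatou_components :: "(complex \<Rightarrow> sphere) \<Rightarrow> sphere set set" where
  "Fatou_components f = connected_components_of (subtopology sphere_top (Fatou f))"


section \<open>Cycles of Herman rings\<close>

definition std_annulus :: "real \<Rightarrow> complex set" where
  "std_annulus R = {\<zeta>. 1 < cmod \<zeta> \<and> cmod \<zeta> < R}"

definition biholomorphic_onto :: "(sphere \<Rightarrow> complex) \<Rightarrow> sphere set \<Rightarrow> complex set \<Rightarrow> bool" where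
  "biholomorphic_onto \<phi> V A \<longleftrightarrow>
     bij_betw \<phi> V A \<and>
     sphere_holomorphic_on (Some \<circ> \<phi>) V \<and>
     sphere_holomorphic_on (inv_into V \<phi> \<circ> the) (Some ` A)"

text \<open>
  The members of the cycle are pairwise distinct, hence disjoint, so that the \<open>p\<close>-th iterate is
  the first return map.
\<close>

definition Herman_ring_cycle ::
    "(complex \<Rightarrow> sphere) \<Rightarrow> nat \<Rightarrow> (nat \<Rightarrow> sphere set) \<Rightarrow> bool" where
  "Herman_ring_cycle f p D \<longleftrightarrow>
     p \<ge> 1 \<and> inj_on D {..<p} \<and>
     (\<forall>i<p. D i \<in> Fatou_components f \<and> iterate f 1 ` D i \<subseteq> D (Suc i mod p)) \<and>
     (\<forall>i<p. \<exists>(R::real) \<phi> (\<theta>::real). R > 1 \<and> \<theta> \<notin> \<rat> \<and>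
        biholomorphic_onto \<phi> (D i) (std_annulus R) \<and>
        (\<forall>x\<in>D i. \<phi> (iterate f p x) = cis (2 * pi * \<theta>) * \<phi> x))"


section \<open>The tangent family\<close>

definition tan_map :: "complex \<Rightarrow> complex \<Rightarrow> sphere" where
  "tan_map l z = (if cos z = 0 then None else Some (l * tan z))"

end

theory Submission
  imports Defs
begin

text \<open>
  Let \<open>f = \<lambda> tan\<close> have a Herman ring \<open>D 0\<close> of period \<open>p\<close>.  The preimage of a circle under the
  uniformization of \<open>D 0\<close> is a Jordan curve that \<open>f\<^sup>p\<close> maps to itself, acting as a rotation by an
  irrational angle.  Let \<open>c k\<close> be its image under \<open>f\<^sup>k\<close>; these are again Jordan curves, and they
  avoid the poles.

  No \<open>c k\<close> encloses a pole (\<open>no_pole_inside\<close>).  As \<open>f\<close> omits the values \<open>\<plusminus>\<lambda>\<i>\<close>, the argument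
  principle says that the winding number of \<open>c (k + 1)\<close> around either of them is, up to sign, the number of
  poles inside \<open>c k\<close> (\<open>winding_number_tan\<close>, \<open>winding_number_counts_poles\<close>).  If that number is not zero,
  then it is one, because \<open>c (k + 1)\<close> is a Jordan curve, and \<open>c (k + 1)\<close> encloses both \<open>\<lambda>\<i>\<close> and \<open>- \<lambda>\<i>\<close>.  A Jordan curve
  enclosing two opposite points intersects its image under \<open>z \<mapsto> - z\<close>
  (\<open>curve_meets_its_negative\<close>).  Since \<open>f\<close> is odd and orbits of an irrational rotation are dense on
  the circle, a single pair of opposite points on \<open>c (k + 1)\<close> forces that curve, and all its images, to be
  symmetric about \<open>0\<close> (\<open>symmetric_image\<close>).  Among the images is \<open>c k\<close>.  With a pole \<open>q\<close> it therefore
  encloses the pole \<open>- q\<close>, which makes two poles instead of one.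

  Without poles in the way, \<open>f\<close> maps the filled curve \<open>c k\<close> into the filled curve \<open>c (k + 1)\<close>
  (\<open>filled_step\<close>).  All orbits starting inside \<open>c 0\<close> are then bounded by one constant, and Montel's
  theorem puts the inside of \<open>c 0\<close> into the Fatou set (\<open>bounded_orbits_subset_Fatou\<close>), hence into
  its component \<open>D 0\<close>.  This is absurd, because the core curve of an annulus surrounds a point of the
  complement (\<open>core_curve_surrounds_hole\<close>).
\<close>


section \<open>Jordan curves and the point reflection\<close>

text \<open>
  The ray from such a point \<open>z\<close> away from the origin never meets \<open>C\<close>.
\<close>

lemma extremal_point_in_outside:
  fixes C :: "complex set"
  assumes C: "\<And>w. w \<in> C \<Longrightarrow> cmod w \<le> cmod z" and z: "z \<notin> C" "z \<noteq> 0"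
  shows "z \<in> outside C"
proof -
  define L where "L = (\<lambda>t. of_real t * z) ` {1::real..}"
  have "connected L"
    unfolding L_def by (intro connected_continuous_image continuous_intros) auto
  moreover have "z \<in> L" by (force simp: L_def)
  moreover have "L \<subseteq> - C"
  proof
    fix w assume "w \<in> L"
    then obtain t where t: "t \<ge> 1" "w = of_real t * z" by (auto simp: L_def)
    show "w \<in> - C"
    proof (cases "t = 1")
      case False
      with t have "cmod w > cmod z" using \<open>z \<noteq> 0\<close> by (simp add: norm_mult)
      with C show ?thesis by force
    qed (use t z in auto)
  qed
  ultimately have sub: "L \<subseteq> connected_component_set (- C) z"
    using connected_component_maximal by blast
  have "\<not> bounded L"
  proof
    assume "bounded L"
    then obtain B where B: "\<And>w. w \<in> L \<Longrightarrow> cmod w \<le> B" by (auto simp: bounded_iff)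
    define t where "t = max 1 ((B + 1) / cmod z)"
    have "of_real t * z \<in> L" by (auto simp: L_def t_def)
    from B[OF this] have "t * cmod z \<le> B" by (simp add: norm_mult t_def)
    moreover have "t * cmod z \<ge> (B + 1) / cmod z * cmod z"
      by (intro mult_right_mono) (auto simp: t_def)
    ultimately show False using \<open>z \<noteq> 0\<close> by simp
  qed
  then show ?thesis using sub bounded_subset by (auto simp: outside)
qed

text \<open>
  Two disjoint Jordan curves whose interiors overlap are nested, and the reflection in \<open>0\<close>
  cannot carry a curve to one strictly inside or strictly around it.  The proof makes this precise at a point \<open>z\<close>
  of the curve of largest modulus: \<open>- z\<close> would lie outside the curve.
\<close>

lemma curve_meets_its_negative:
  fixes c :: "real \<Rightarrow> complex"
  assumes c: "simple_path c" "pathfinish c = pathstart c"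
    and w: "w \<in> inside (path_image c)" "- w \<in> inside (path_image c)"
  shows "path_image c \<inter> uminus ` path_image c \<noteq> {}"
proof
  define C B where "C = path_image c" and "B = inside C"
  assume "path_image c \<inter> uminus ` path_image c = {}"
  then have disj: "C \<inter> uminus ` C = {}" by (simp add: C_def)
  have J: "open (outside C)" "connected B" "frontier B = C"
    using Jordan_inside_outside[OF c] by (simp_all add: B_def C_def)
  have cmp: "compact C" and conn: "connected C" and ne: "C \<noteq> {}"
    using c by (auto simp: C_def compact_simple_path_image connected_simple_path_image)
  obtain z where z: "z \<in> C" "\<And>w. w \<in> C \<Longrightarrow> cmod w \<le> cmod z"
    using continuous_attains_sup[OF cmp ne, of cmod] by (auto intro: continuous_intros)
  have z': "- z \<notin> C" using z(1) disj by blast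
  then have "z \<noteq> 0" using z(1) by auto
  then have out: "- z \<in> outside C"
    using extremal_point_in_outside[of C "- z"] z z' by auto
  have sep: "T \<inter> C \<noteq> {}" if "connected T" "x \<in> T" "x \<in> B" "y \<in> T" "y \<in> outside C" for T x y
    using inside_outside_intersect_connected[of T C] that by (auto simp: B_def)
  \<comment> \<open>The point \<open>- z\<close> of \<open>- C\<close> is outside, so all of the connected set \<open>- C\<close> is.\<close>
  have "connected (uminus ` C)"
    by (intro connected_continuous_image conn continuous_intros)
  then have BC: "uminus ` C \<inter> B = {}"
    using sep[of "uminus ` C" _ "- z"] out z(1) disj by blast
  \<comment> \<open>Hence \<open>- B\<close> does not meet \<open>C\<close> and stays where its point \<open>w\<close> is, on the inner side.\<close>
  have "connected (uminus ` B)"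
    by (intro connected_continuous_image J continuous_intros)
  moreover have "uminus ` B \<inter> C = {}"
    using BC by force
  moreover have "w \<in> uminus ` B" using w by (force simp: B_def C_def)
  ultimately have "uminus ` B \<inter> outside C = {}"
    using sep[of "uminus ` B" w] w(1) unfolding B_def[symmetric] C_def[symmetric] by blast
  then have "uminus ` outside C \<inter> B = {}" by force
  then have "uminus ` outside C \<inter> closure B = {}"
    using open_Int_closure_eq_empty[OF open_negations[OF J(1)]] by simp
  moreover have "z \<in> closure B" using J z(1) by (auto simp: frontier_def)
  moreover have "z \<in> uminus ` outside C" using out by force
  ultimately show False by blast
qed

lemma symmetric_curve_inside:
  fixes c :: "real \<Rightarrow> complex"
  assumes c: "simple_path c" "pathfinish c = pathstart c"
    and sym: "uminus ` path_image c = path_image c" and q: "q \<in> inside (path_image c)"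
  shows "- q \<in> inside (path_image c)"
proof (rule ccontr)
  define C where "C = path_image c"
  have J: "connected (outside C)" "bounded (inside C)" "\<not> bounded (outside C)"
    using Jordan_inside_outside[OF c] by (simp_all add: C_def)
  assume "- q \<notin> inside (path_image c)"
  moreover have "- q \<notin> C"
  proof
    assume "- q \<in> C"
    then have "q \<in> uminus ` C" by force
    then show False using q sym inside_no_overlap[of C] unfolding C_def by blast
  qed
  ultimately have o: "- q \<in> outside C" by (simp add: C_def outside_inside)
  have d: "uminus ` outside C \<inter> C = {}"
  proof -
    have "uminus ` outside C \<inter> uminus ` C = {}"
      using outside_no_overlap[of C] by (simp add: image_Int[symmetric] Int_commute)
    then show ?thesis using sym by (simp only: C_def)
  qed
  have "connected (uminus ` outside C)"
    by (intro connected_continuous_image J continuous_intros)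
  moreover have "q \<in> uminus ` outside C" using o by force
  ultimately have "uminus ` outside C \<inter> outside C = {}"
    using inside_outside_intersect_connected[of "uminus ` outside C" C] q d
    unfolding C_def[symmetric] by blast
  with d have "uminus ` outside C \<subseteq> inside C" by (auto simp: inside_outside)
  then show False using J bounded_subset[of "inside C" "uminus ` outside C"] by simp
qed

section \<open>Poles and asymptotic values of the tangent\<close>

text \<open>
  Since \<open>s\<^sup>2 = - 1\<close>, the product of \<open>sin z - s cos z\<close> and \<open>sin z + s cos z\<close> is \<open>1\<close>.  So the tangent omits
  \<open>s\<close>, and the logarithmic derivative of \<open>tan - s\<close> differs from that of \<open>1 / cos\<close> by a constant.
\<close>

lemma tan_diff_asymptotic:
  assumes "cos z \<noteq> 0" and s: "s = \<i> \<or> s = - \<i>"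
  shows "tan z \<noteq> s" "(inverse ((cos z)\<^sup>2)) / (tan z - s) = s + sin z / cos z"
proof -
  have s2: "s\<^sup>2 = - 1" "s * s = -1" using s by auto
  have "(sin z - s * cos z) * (sin z + s * cos z) = (sin z)\<^sup>2 - s\<^sup>2 * (cos z)\<^sup>2"
    by (simp add: algebra_simps power2_eq_square)
  then have prod: "(sin z - s * cos z) * (sin z + s * cos z) = 1"
    using sin_cos_squared_add[of z] s2 by simp
  then have ne: "sin z - s * cos z \<noteq> 0" by auto
  with assms show "tan z \<noteq> s" by (auto simp: tan_def field_simps)
  have "sin z + s * cos z = 1 / (sin z - s * cos z)"
    using prod ne by (simp add: field_simps)
  then have "s + sin z / cos z = 1 / (sin z - s * cos z) / cos z"
    using assms(1) by (simp add: field_simps)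
  also have "\<dots> = (inverse ((cos z)\<^sup>2)) / (tan z - s)"
    using assms(1) ne by (simp add: tan_def field_simps power2_eq_square)
  finally show "(inverse ((cos z)\<^sup>2)) / (tan z - s) = s + sin z / cos z" by simp
qed

lemma finite_cos_zeros: "finite {z \<in> ball 0 M. cos z = (0::complex)}"
proof -
  have "finite {z \<in> cball 0 M. cos z = (0::complex)}"
  proof (rule holomorphic_compact_finite_zeros[where S = UNIV])
    show "\<not> (cos::complex \<Rightarrow> complex) constant_on UNIV"
    proof
      assume "(cos::complex \<Rightarrow> complex) constant_on UNIV"
      then have "cos (0::complex) = cos (of_real pi)" unfolding constant_on_def by (metis UNIV_I)
      then show False unfolding cos_of_real by simp
    qed
  qed (auto intro!: holomorphic_intros)
  then show ?thesis by (rule rev_finite_subset) auto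
qed

lemma zorder_cos_pos:
  assumes "cos z = (0::complex)"
  shows "zorder cos z > 0"
proof -
  have "\<exists>w\<in>UNIV. cos w \<noteq> (0::complex)" by (metis UNIV_I cos_zero zero_neq_one)
  then show ?thesis
    using zorder_exist_zero[of cos UNIV z] assms holomorphic_on_cos by auto
qed

text \<open>
  The winding number of the image curve around the asymptotic value \<open>l * s\<close> is, up to the factor \<open>2 \<pi> \<i>\<close>, the integral of the
  logarithmic derivative \<open>s + sin z / cos z\<close> of \<open>tan - s\<close>.  The constant integrates to \<open>0\<close>, and what
  remains is minus the logarithmic derivative of \<open>cos\<close>, so that the argument principle for the
  entire function \<open>cos\<close> applies.  In other words: the argument principle for a function omitting a
  value counts only its poles.
\<close>

lemma winding_number_tan:
  assumes c: "valid_path c" "pathfinish c = pathstart c"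
    and l: "l \<noteq> 0" and np: "\<And>z. z \<in> path_image c \<Longrightarrow> cos z \<noteq> 0"
    and s: "s = \<i> \<or> s = - \<i>" and M: "path_image c \<subseteq> ball 0 M"
  shows "winding_number ((\<lambda>z. l * tan z) \<circ> c) (l * s) =
           - (\<Sum>q\<in>{z \<in> ball 0 M. cos z = 0}. winding_number c q * of_int (zorder cos q))"
proof -
  define S where "S = {z::complex. cos z \<noteq> 0}"
  define g where "g = (\<lambda>z. l * tan z)"
  have opS: "open S" unfolding S_def
    by (intro open_Collect_neq continuous_intros)
  have cS: "path_image c \<subseteq> S" using np by (auto simp: S_def)
  have holg: "g holomorphic_on S" unfolding g_def S_def tan_def by (intro holomorphic_intros) auto
  have dg: "deriv g z = l * inverse ((cos z)\<^sup>2)" if "z \<in> S" for z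
    using that unfolding g_def S_def
    by (intro DERIV_imp_deriv) (auto intro!: derivative_eq_intros)
  have vg: "valid_path (g \<circ> c)"
    using valid_path_compose_holomorphic[OF c(1) holg opS cS] .
  have notin: "l * s \<notin> path_image (g \<circ> c)"
  proof
    assume "l * s \<in> path_image (g \<circ> c)"
    then obtain z where z: "z \<in> path_image c" "l * s = l * tan z"
      by (auto simp: path_image_compose g_def)
    show False using tan_diff_asymptotic(1)[OF np[OF z(1)] s] z(2) l by simp
  qed
  have holtan: "(\<lambda>z. sin z / cos z) holomorphic_on S"
    unfolding S_def by (intro holomorphic_intros) auto
  have "2 * pi * \<i> * winding_number (g \<circ> c) (l * s)
      = contour_integral (g \<circ> c) (\<lambda>w. 1 / (w - l * s))"
    using winding_number_valid_path[OF vg notin] by simp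
  also have "\<dots> = contour_integral c (\<lambda>w. deriv g w * (1 / (g w - l * s)))"
    using holg opS by (intro contour_integral_comp_analyticW[OF _ c(1) cS]) (simp add: analytic_on_open)
  also have "\<dots> = contour_integral c (\<lambda>w. s + sin w / cos w)"
  proof (rule contour_integral_eq)
    fix z assume "z \<in> path_image c"
    then have z: "z \<in> S" "cos z \<noteq> 0" using cS np by auto
    have "deriv g z * (1 / (g z - l * s)) = (l * inverse ((cos z)\<^sup>2)) / (l * (tan z - s))"
      using dg[OF z(1)] by (simp add: g_def algebra_simps)
    also have "\<dots> = inverse ((cos z)\<^sup>2) / (tan z - s)" using l by simp
    also have "\<dots> = s + sin z / cos z" using tan_diff_asymptotic(2)[OF z(2) s] .
    finally show "deriv g z * (1 / (g z - l * s)) = s + sin z / cos z" .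
  qed
  also have "\<dots> = contour_integral c (\<lambda>w. s) + contour_integral c (\<lambda>w. sin w / cos w)"
    by (intro contour_integral_add contour_integrable_holomorphic_simple[OF _ opS c(1) cS]
         holtan holomorphic_intros)
  also have "contour_integral c (\<lambda>w. s) = 0"
    using c by (intro contour_integral_unique Cauchy_theorem_convex_simple[where S = UNIV])
      (auto intro!: holomorphic_intros)
  also have "contour_integral c (\<lambda>w. sin w / cos w)
      = - contour_integral c (\<lambda>w. deriv cos w * 1 / cos w)"
  proof -
    have "contour_integral c (\<lambda>w. deriv cos w * 1 / cos w) = contour_integral c (\<lambda>w. - (sin w / cos w))"
      by (intro contour_integral_eq) (simp add: DERIV_imp_deriv[OF DERIV_cos])
    also have "\<dots> = - contour_integral c (\<lambda>w. sin w / cos w)"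
      by (intro contour_integral_neg contour_integrable_holomorphic_simple[OF holtan opS c(1) cS])
    finally show ?thesis by simp
  qed
  also have "contour_integral c (\<lambda>w. deriv cos w * 1 / cos w) =
     2 * pi * \<i> * (\<Sum>q\<in>{w \<in> ball 0 M. cos w = 0 \<or> w \<in> {}}. winding_number c q * 1 * zorder cos q)"
  proof (rule argument_principle)
    show "\<forall>z. z \<notin> ball 0 M \<longrightarrow> winding_number c z = 0"
    proof (intro allI impI)
      fix z :: complex assume "z \<notin> ball 0 M"
      then show "winding_number c z = 0"
        using winding_number_zero_outside[OF valid_path_imp_path[OF c(1)] convex_ball c(2) _ M]
        by blast
    qed
    show "path_image c \<subseteq> ball 0 M - {w \<in> ball 0 M. cos w = 0 \<or> w \<in> {}}"
      using M np by blast
    show "finite {w \<in> ball 0 M. cos w = 0 \<or> w \<in> ({}::complex set)}"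
      using finite_cos_zeros by simp
  qed (use c in \<open>simp_all add: holomorphic_on_cos\<close>)
  finally have "2 * pi * \<i> * winding_number (g \<circ> c) (l * s) = 2 * pi * \<i> *
      - (\<Sum>q\<in>{z \<in> ball 0 M. cos z = 0}. winding_number c q * of_int (zorder cos q))"
    by (simp only: empty_iff simp_thms mult_1_right add_0_left mult_minus_right)
  moreover have "2 * pi * \<i> \<noteq> (0::complex)" by simp
  ultimately show ?thesis unfolding g_def by (rule mult_left_cancel[THEN iffD1, rotated])
qed

section \<open>Cycles of rotating curves\<close>

text \<open>
  The multiples of an irrational number are dense modulo \<open>1\<close> (Kronecker).
\<close>

lemma rotation_invariant_closed_set_UNIV:
  fixes S :: "real set"
  assumes irr: "\<theta> \<notin> \<rat>" and "closed S" and s: "s \<in> S"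
    and rot: "\<And>t. t \<in> S \<Longrightarrow> t + \<theta> \<in> S" and per: "\<And>t. t \<in> S \<Longrightarrow> t - 1 \<in> S" "\<And>t. t \<in> S \<Longrightarrow> t + 1 \<in> S"
  shows "S = UNIV"
proof -
  have rots: "t + real n * \<theta> \<in> S" if "t \<in> S" for t n
  proof (induction n)
    case (Suc n)
    show ?case using rot[OF Suc] by (simp add: algebra_simps)
  qed (use that in simp)
  have pers: "t + of_int m \<in> S" if "t \<in> S" for t m
  proof (induction m rule: int_induct[where k = 0])
    case (step1 i) then show ?case using per(2)[OF step1(2)] by (simp add: algebra_simps)
  next
    case (step2 i) then show ?case using per(1)[OF step2(2)] by (simp add: algebra_simps)
  qed (use that in simp)
  have "x \<in> closure S" for x
    unfolding closure_approachable
  proof (intro allI impI)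
    fix e :: real assume "e > 0"
    obtain n h where "\<bar>real n * \<theta> - real_of_int h - (x - s)\<bar> < e"
    proof -
      obtain k where k: "\<bar>frac (real k * \<theta>) - frac (x - s)\<bar> < e"
        using Kronecker_approx_1_explicit[OF irr _ _ \<open>e > 0\<close>, of "frac (x - s)"]
        by (metis frac_ge_0 frac_lt_1 less_le)
      then have "\<bar>real k * \<theta> - real_of_int (\<lfloor>real k * \<theta>\<rfloor> - \<lfloor>x - s\<rfloor>) - (x - s)\<bar> < e"
        by (simp add: frac_def)
      then show thesis using that by blast
    qed
    then have "dist (s + real n * \<theta> + of_int (- h)) x < e" by (simp add: dist_real_def algebra_simps)
    then show "\<exists>y\<in>S. dist y x < e" using pers[OF rots[OF s]] by blast
  qed
  then show ?thesis using \<open>closed S\<close> by auto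
qed

text \<open>
  The curves to which the argument is applied: the images \<open>c k\<close>, under the iterates of the map, of an
  invariant circle of a Herman ring, parametrized over the whole line with period \<open>1\<close> so that the
  \<open>p\<close>-th iterate is the translation by \<open>\<theta>\<close>.
\<close>

locale rotating_tan_curves =
  fixes l :: complex and \<theta> :: real and p :: nat and c :: "nat \<Rightarrow> real \<Rightarrow> complex"
  assumes l: "l \<noteq> 0" and irr: "\<theta> \<notin> \<rat>" and p: "p \<ge> 1"
    and valid: "valid_path (c k)" and simple: "simple_path (c k)"
    and cont: "continuous_on UNIV (c k)"
    and period: "c k (t + 1) = c k t"
    and no_pole: "cos (c k t) \<noteq> 0"
    and step: "c (Suc k) t = l * tan (c k t)"
    and rot: "c (k + p) t = c k (t + \<theta>)"
begin

lemma period': "c k (t - 1) = c k t"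
  using period[of k "t - 1"] by simp

lemma loop: "pathfinish (c k) = pathstart (c k)"
  using period[of k 0] by (simp add: pathfinish_def pathstart_def)

lemma path_image_range: "path_image (c k) = range (c k)"
proof -
  have per: "c k (t + of_int m) = c k t" for t m
  proof (induction m rule: int_induct[where k = 0])
    case (step1 i) then show ?case using period[of k "t + of_int i"] by (simp add: add.assoc)
  next
    case (step2 i) then show ?case using period'[of k "t + of_int i"] by (simp add: algebra_simps)
  qed simp
  have "c k t \<in> c k ` {0..1}" for t
  proof -
    have "c k t = c k (frac t)" using per[of "frac t" "\<lfloor>t\<rfloor>"] by (simp add: frac_def)
    then show ?thesis using frac_ge_0[of t] frac_lt_1[of t] by (metis atLeastAtMost_iff image_eqI less_imp_le)
  qed
  then show ?thesis by (auto simp: path_image_def)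
qed

lemma path_image_p: "path_image (c (k + p)) = path_image (c k)"
proof -
  have "c (k + p) = c k \<circ> (\<lambda>t. t + \<theta>)" by (auto simp: rot)
  moreover have "range (\<lambda>t. t + \<theta>) = UNIV" using surj_plus_right[of \<theta>] by simp
  ultimately show ?thesis unfolding path_image_range by (metis image_comp)
qed

lemma path_image_step: "path_image (c (Suc k)) = (\<lambda>z. l * tan z) ` path_image (c k)"
  unfolding path_image_range by (simp add: step image_image)

lemma cos_path_image: "z \<in> path_image (c k) \<Longrightarrow> cos z \<noteq> 0"
  using no_pole by (auto simp: path_image_range)

lemma asymptotic_notin:
  assumes "s = \<i> \<or> s = - \<i>" shows "l * s \<notin> path_image (c (Suc k))"
proof
  assume "l * s \<in> path_image (c (Suc k))"
  then obtain t where t: "l * s = l * tan (c k t)" by (auto simp: path_image_range step)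
  then show False using tan_diff_asymptotic(1)[OF no_pole assms, of k t] l by simp
qed

lemma antisymmetric_step:
  assumes "c k (t + d) = - c k t" shows "c (k + j) (t + d) = - c (k + j) t"
  using assms by (induction j) (simp_all add: step)

text \<open>
  If \<open>c k s' = - c k s\<close>, then with \<open>d = s' - s\<close> the relation \<open>c k (t + d) = - c k t\<close> holds at \<open>t = s\<close>, and as
  the map is odd it is inherited from \<open>t\<close> by \<open>t + \<theta>\<close>.  By density it holds for all \<open>t\<close>.
\<close>

lemma symmetric_image:
  assumes "path_image (c k) \<inter> uminus ` path_image (c k) \<noteq> {}"
  shows "uminus ` path_image (c (k + j)) = path_image (c (k + j))"
proof -
  obtain s s' where ss: "c k s' = - c k s"
    using assms by (auto simp: path_image_range)
  define d where "d = s' - s"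
  define S where "S = {t. c k (t + d) = - c k t}"
  have "S = UNIV"
  proof (rule rotation_invariant_closed_set_UNIV[OF irr])
    show "closed S" unfolding S_def
      by (intro closed_Collect_eq continuous_intros continuous_on_compose2[OF cont]) auto
    show "s \<in> S" using ss by (simp add: S_def d_def)
    show "t + \<theta> \<in> S" if "t \<in> S" for t
      using antisymmetric_step[of k t d p] that by (simp add: S_def rot algebra_simps)
    show "t - 1 \<in> S" "t + 1 \<in> S" if "t \<in> S" for t
    proof -
      have "t - 1 + d = t + d - 1" "t + 1 + d = t + d + 1" by simp_all
      then show "t - 1 \<in> S" "t + 1 \<in> S"
        using that unfolding S_def mem_Collect_eq by (simp_all only: period period')
    qed
  qed
  then have "c k (t + d) = - c k t" for t
    unfolding S_def by (metis (mono_tags) UNIV_I mem_Collect_eq)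
  then have "c (k + j) (t + d) = - c (k + j) t" for t
    by (rule antisymmetric_step)
  then have "- c (k + j) t \<in> range (c (k + j))" for t by (metis rangeI)
  then have "uminus ` range (c (k + j)) \<subseteq> range (c (k + j))" by auto
  moreover from this have "range (c (k + j)) \<subseteq> uminus ` range (c (k + j))"
    using image_mono[of "uminus ` range (c (k + j))" "range (c (k + j))" uminus]
    by (simp add: image_image)
  ultimately show ?thesis unfolding path_image_range by blast
qed

text \<open>
  The points of \<open>P\<close> are the poles inside \<open>c k\<close>.  As \<open>c k\<close> is a Jordan curve, all of them count with the
  same sign \<open>e\<close>, so that there can be no cancellation.
\<close>

lemma winding_number_counts_poles:
  obtains e :: int and P where "e = 1 \<or> e = - 1" "finite P"
    "P = {q \<in> inside (path_image (c k)). cos q = 0}"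
    "\<And>s. s = \<i> \<or> s = - \<i> \<Longrightarrow>
       winding_number (c (Suc k)) (l * s) = - of_int (e * (\<Sum>q\<in>P. zorder cos q))"
proof -
  define C where "C = path_image (c k)"
  define P where "P = {q \<in> inside C. cos q = 0}"
  have "compact C" unfolding C_def by (rule compact_simple_path_image[OF simple])
  then have "bounded (C \<union> inside C)"
    using Jordan_inside_outside[OF simple[of k] loop] compact_imp_bounded by (simp add: C_def)
  then obtain M where M: "C \<union> inside C \<subseteq> ball 0 M"
    using bounded_subset_ballD by blast
  define Z where "Z = {z \<in> ball 0 M. cos z = (0::complex)}"
  have fin: "finite Z" unfolding Z_def by (rule finite_cos_zeros)
  have PZ: "P \<subseteq> Z" using M by (auto simp: P_def Z_def)
  obtain e :: int where e: "e = 1 \<or> e = - 1" "\<And>z. z \<in> inside C \<Longrightarrow> winding_number (c k) z = of_int e"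
    using simple_closed_path_winding_number_inside[OF simple[of k]] unfolding C_def
    by (metis of_int_1 of_int_minus)
  have w0: "winding_number (c k) z = 0" if "z \<in> Z - P" for z
  proof -
    have "z \<notin> C" using that cos_path_image by (auto simp: Z_def C_def)
    then have "z \<in> outside C" using that by (auto simp: Z_def P_def inside_outside)
    then show ?thesis
      using winding_number_zero_in_outside[OF valid_path_imp_path[OF valid] loop] by (simp add: C_def)
  qed
  have "winding_number (c (Suc k)) (l * s) = - of_int (e * (\<Sum>q\<in>P. zorder cos q))"
    if s: "s = \<i> \<or> s = - \<i>" for s
  proof -
    have eq: "c (Suc k) = (\<lambda>z. l * tan z) \<circ> c k" by (auto simp: step)
    have "winding_number (c (Suc k)) (l * s) =
           - (\<Sum>q\<in>Z. winding_number (c k) q * of_int (zorder cos q))"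
      unfolding eq Z_def using M cos_path_image l s
      by (intro winding_number_tan valid loop) (auto simp: C_def)
    also have "(\<Sum>q\<in>Z. winding_number (c k) q * of_int (zorder cos q))
       = (\<Sum>q\<in>P. winding_number (c k) q * of_int (zorder cos q))"
      using w0 by (intro sum.mono_neutral_right fin PZ) auto
    also have "\<dots> = (\<Sum>q\<in>P. of_int e * of_int (zorder cos q))"
      by (intro sum.cong) (auto simp: P_def e(2))
    finally show ?thesis by (simp add: sum_distrib_left)
  qed
  then show thesis using that[of e P] e(1) finite_subset[OF PZ fin] unfolding P_def C_def by blast
qed

text \<open>
  If the curve encloses a pole, the next one has nonzero winding number around both asymptotic values
  \<open>l * \<i>\<close> and \<open>- l * \<i>\<close>; being a Jordan curve it has winding number \<open>\<plusminus>1\<close>, so the pole was the only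
  one.  On the other hand the next curve surrounds a pair of opposite points, so it meets its own
  negative and is symmetric; by periodicity the original curve is symmetric as well and encloses the
  opposite pole too.
\<close>

lemma no_pole_inside:
  assumes "q \<in> inside (path_image (c k))" shows "cos q \<noteq> 0"
proof
  assume "cos q = 0"
  obtain e P where e: "e = 1 \<or> e = - 1" and fin: "finite P"
    and P: "P = {q \<in> inside (path_image (c k)). cos q = 0}"
    and w: "\<And>s. s = \<i> \<or> s = - \<i> \<Longrightarrow>
       winding_number (c (Suc k)) (l * s) = - of_int (e * (\<Sum>q\<in>P. zorder cos q))"
    using winding_number_counts_poles[of k] by blast
  define m where "m = (\<Sum>q\<in>P. zorder cos q)"
  have zo: "zorder cos z \<ge> 1" if "z \<in> P" for z using that zorder_cos_pos[of z] by (auto simp: P)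
  have card: "int (card A) \<le> m" if "A \<subseteq> P" for A
  proof -
    have "int (card A) \<le> int (card P)" using card_mono[OF fin that] by simp
    also have "\<dots> = (\<Sum>q\<in>P. 1)" by simp
    also have "\<dots> \<le> m" unfolding m_def by (intro sum_mono zo)
    finally show ?thesis .
  qed
  have q: "q \<in> P" using assms \<open>cos q = 0\<close> by (simp add: P)
  then have m1: "m \<ge> 1" using card[of "{q}"] by simp
  have "winding_number (c (Suc k)) (l * \<i>) \<in> {-1, 0, 1}"
    using simple_closed_path_winding_number_cases[OF simple loop asymptotic_notin[of \<i>]] by simp
  moreover have "winding_number (c (Suc k)) (l * \<i>) = of_int (- (e * m))"
    using w[of \<i>] unfolding m_def[symmetric] by simp
  ultimately have "(of_int (- (e * m)) :: complex) \<in> of_int ` {-1, 0, 1}" by simp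
  then have "- (e * m) \<in> {-1, 0, 1}" by (metis (no_types) imageE of_int_eq_iff)
  then have m: "m = 1" using e m1 by (elim disjE) auto
  have ins: "l * s \<in> inside (path_image (c (Suc k)))" if "s = \<i> \<or> s = - \<i>" for s
  proof (rule ccontr)
    assume "\<not> ?thesis"
    then have "l * s \<in> outside (path_image (c (Suc k)))"
      using asymptotic_notin[OF that, of k] inside_Un_outside by blast
    then have "winding_number (c (Suc k)) (l * s) = 0"
      using winding_number_zero_in_outside[OF valid_path_imp_path[OF valid] loop] by simp
    then show False using w[OF that] e unfolding m_def[symmetric] m by auto
  qed
  have "path_image (c (Suc k)) \<inter> uminus ` path_image (c (Suc k)) \<noteq> {}"
    using curve_meets_its_negative[OF simple loop ins[of \<i>]] ins[of "- \<i>"] by simp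
  \<comment> \<open>\<open>p - 1\<close> further steps lead back to the image of \<open>c k\<close>.\<close>
  then have "uminus ` path_image (c (Suc k + (p - 1))) = path_image (c (Suc k + (p - 1)))"
    by (rule symmetric_image)
  then have "uminus ` path_image (c k) = path_image (c k)"
    using p path_image_p[of k] by simp
  then have "- q \<in> inside (path_image (c k))"
    using symmetric_curve_inside[OF simple loop _ assms] by blast
  then have "{q, - q} \<subseteq> P" using q \<open>cos q = 0\<close> by (simp add: P)
  moreover have "q \<noteq> - q" using \<open>cos q = 0\<close> by auto
  ultimately show False using card[of "{q, - q}"] m by simp
qed

text \<open>
  Once there are no poles inside, the map is holomorphic on the filled curve \<open>K\<close>.  The part of the image
  of \<open>K\<close> outside the next curve is relatively closed by compactness and relatively open by the open
  mapping theorem, because the boundary of \<open>K\<close> contributes nothing to it.  The exterior is connected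
  and unbounded, so this part is empty.
\<close>

lemma filled_step:
  assumes "z \<in> path_image (c k) \<union> inside (path_image (c k))"
  shows "l * tan z \<in> path_image (c (Suc k)) \<union> inside (path_image (c (Suc k)))"
proof (rule ccontr)
  define K B C' where "K = path_image (c k) \<union> inside (path_image (c k))"
    and "B = inside (path_image (c k))" and "C' = path_image (c (Suc k))"
  define g where "g = (\<lambda>z. l * tan z)"
  have J: "B \<noteq> {}" "open B" "connected B" "bounded B"
    using Jordan_inside_outside[OF simple[of k] loop] by (simp_all add: B_def)
  have J': "connected (outside C')" "\<not> bounded (outside C')"
    using Jordan_inside_outside[OF simple[of "Suc k"] loop] by (simp_all add: C'_def)
  assume "\<not> ?thesis"
  then have out: "g z \<in> outside C'" unfolding g_def C'_def inside_outside by blast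
  have cK: "cos z \<noteq> 0" if "z \<in> K" for z
    using that cos_path_image no_pole_inside by (auto simp: K_def)
  have holg: "g holomorphic_on K" unfolding g_def tan_def
    by (intro holomorphic_intros) (use cK in auto)
  have "bounded K"
    using compact_imp_bounded[OF compact_simple_path_image[OF simple[of k]]] J
    by (simp add: K_def B_def)
  moreover have "closed K"
    unfolding K_def by (rule closed_path_image_Un_inside[OF valid_path_imp_path[OF valid]])
  ultimately have "compact K" by (simp add: compact_eq_bounded_closed)
  then have cgK: "compact (g ` K)"
    using compact_continuous_image holomorphic_on_imp_continuous_on[OF holg] by blast
  have opn: "open (g ` B)"
  proof (rule open_mapping_thm[of _ B])
    show "g holomorphic_on B" using holg holomorphic_on_subset by (auto simp: K_def B_def)
    show "\<not> g constant_on B"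
    proof
      assume "g constant_on B"
      then obtain a where a: "\<And>z. z \<in> B \<Longrightarrow> g z = a" by (auto simp: constant_on_def)
      obtain b where b: "b \<in> B" using J by blast
      have "deriv g b = l * inverse ((cos b)\<^sup>2)"
        using cK[of b] b unfolding g_def K_def B_def
        by (intro DERIV_imp_deriv) (auto intro!: derivative_eq_intros)
      moreover have "deriv g b = deriv (\<lambda>_. a) b"
        using J b a by (intro deriv_cong_ev refl eventually_nhds[THEN iffD2]) blast
      ultimately show False using l cK[of b] b by (simp add: K_def B_def)
    qed
  qed (use J in auto)
  have "outside C' \<inter> g ` K = outside C' \<inter> g ` B"
  proof -
    have "g ` path_image (c k) = C'" by (simp add: C'_def path_image_step g_def)
    then show ?thesis using outside_no_overlap[of C'] 
      unfolding K_def B_def image_Un by blast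
  qed
  then have "openin (top_of_set (outside C')) (outside C' \<inter> g ` K)"
    using opn by (simp add: openin_open_Int)
  moreover have "closedin (top_of_set (outside C')) (outside C' \<inter> g ` K)"
    using cgK by (simp add: closedin_closed_Int compact_imp_closed)
  ultimately have "outside C' \<inter> g ` K = {} \<or> outside C' \<inter> g ` K = outside C'"
    using J' connected_clopen by blast
  then have "outside C' \<subseteq> g ` K" using out assms by (auto simp: K_def)
  then show False using J'(2) bounded_subset[OF compact_imp_bounded[OF cgK]] by blast
qed

lemma path_image_mod: "path_image (c (j + n * p)) = path_image (c j)"
proof (induction n)
  case (Suc n)
  then show ?case using path_image_p[of "j + n * p"] by (simp add: algebra_simps)
qed simp

text \<open>
  The \<open>n\<close>-th iterate stays in the \<open>n\<close>-th filled curve.  These curves are bounded and repeat with period \<open>p\<close>,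
  which gives a bound independent of \<open>n\<close>.
\<close>

lemma bounded_orbits_inside:
  obtains M where "\<And>z n. z \<in> inside (path_image (c 0)) \<Longrightarrow>
      cos (((\<lambda>z. l * tan z) ^^ n) z) \<noteq> 0 \<and> cmod (((\<lambda>z. l * tan z) ^^ n) z) \<le> M"
proof -
  define K where "K = (\<lambda>k. path_image (c k) \<union> inside (path_image (c k)))"
  have "bounded (\<Union>k<p. K k)"
    using Jordan_inside_outside[OF simple loop] compact_imp_bounded[OF compact_simple_path_image[OF simple]]
    by (auto simp: K_def)
  then obtain M where M: "\<And>z. z \<in> (\<Union>k<p. K k) \<Longrightarrow> cmod z \<le> M" by (auto simp: bounded_iff)
  have orb: "((\<lambda>z. l * tan z) ^^ n) z \<in> K n" if "z \<in> inside (path_image (c 0))" for z n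
  proof (induction n)
    case (Suc n)
    then show ?case using filled_step[of _ n] by (simp add: K_def)
  qed (use that in \<open>simp add: K_def\<close>)
  have cosK: "cos z \<noteq> 0" if "z \<in> K n" for z n
    using that cos_path_image no_pole_inside by (auto simp: K_def)
  have "K n = K (n mod p)" for n
    using path_image_mod[of "n mod p" "n div p"] by (simp add: K_def)
  then have "K n \<subseteq> (\<Union>k<p. K k)" for n using p 
    using mod_less_divisor[of p n] by (metis UN_upper lessThan_iff less_le_trans zero_less_one)
  then have "cmod z \<le> M" if "z \<in> K n" for z n using M that by blast
  then show thesis using that[of M] orb cosK by blast
qed

end

section \<open>Normal families on the sphere\<close>

lemma open_Some_vimage:
  assumes "openin sphere_top V" shows "open {z. Some z \<in> V}"
  using openin_continuous_map_preimage[OF continuous_map_Some assms] by simp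

text \<open>
  A map that is finite and holomorphic on a plane domain is holomorphic in the other charts, too: there
  it is represented by \<open>1 / h z\<close>, \<open>h (1 / z)\<close> or \<open>1 / h (1 / z)\<close>.
\<close>

lemma sphere_holomorphic_on_SomeI:
  assumes "open U" and hol: "h holomorphic_on U" and F: "\<And>z. z \<in> U \<Longrightarrow> F (Some z) = Some (h z)"
  shows "sphere_holomorphic_on F (Some ` U)"
  unfolding sphere_holomorphic_on_def
proof (intro conjI ballI)
  show op: "openin sphere_top (Some ` U)" using \<open>open U\<close> by simp
  show "continuous_map (subtopology sphere_top (Some ` U)) sphere_top F"
    unfolding continuous_map_def
  proof (intro conjI allI impI)
    show "F \<in> topspace (subtopology sphere_top (Some ` U)) \<rightarrow> topspace sphere_top"
      using F by (auto simp: notin_range_Some)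
    fix V assume "openin sphere_top V"
    then have "open (U \<inter> h -` {w. Some w \<in> V})"
      using continuous_open_preimage[OF holomorphic_on_imp_continuous_on[OF hol] \<open>open U\<close>]
        open_Some_vimage by blast
    then have "openin sphere_top (Some ` (U \<inter> h -` {w. Some w \<in> V}))" by simp
    moreover have "Some ` (U \<inter> h -` {w. Some w \<in> V})
        = {x \<in> topspace (subtopology sphere_top (Some ` U)). F x \<in> V}"
      using F by auto
    ultimately have "openin sphere_top
        {x \<in> topspace (subtopology sphere_top (Some ` U)). F x \<in> V}" by (simp only:)
    then show "openin (subtopology sphere_top (Some ` U))
        {x \<in> topspace (subtopology sphere_top (Some ` U)). F x \<in> V}"
      unfolding openin_open_subtopology[OF op] by auto
  qed
  have inv: "(\<lambda>z. h (1 / z)) holomorphic_on {z. z \<noteq> 0 \<and> 1 / z \<in> U}"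
    by (rule holomorphic_on_compose_gen[OF _ hol, of "\<lambda>z. 1 / z", unfolded comp_def])
      (auto intro!: holomorphic_intros)
  fix a b :: "sphere \<Rightarrow> sphere"
  assume "a \<in> {id, sphere_inv}" "b \<in> {id, sphere_inv}"
  then consider "a = id" "b = id" | "a = id" "b = sphere_inv"
    | "a = sphere_inv" "b = id" | "a = sphere_inv" "b = sphere_inv" by blast
  then show "(\<lambda>z. the (b (F (a (Some z))))) holomorphic_on
      {z. a (Some z) \<in> Some ` U \<and> b (F (a (Some z))) \<noteq> None}"
  proof cases
    case 1
    show ?thesis
      by (rule holomorphic_transform[OF holomorphic_on_subset[OF hol]]) (auto simp: 1 F)
  next
    case 2
    have "(\<lambda>z. 1 / h z) holomorphic_on {z \<in> U. h z \<noteq> 0}"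
      by (intro holomorphic_intros holomorphic_on_subset[OF hol]) auto
    then show ?thesis
      by (rule holomorphic_transform[OF holomorphic_on_subset]) (auto simp: 2 F split: if_splits)
  next
    case 3
    show ?thesis
      by (rule holomorphic_transform[OF holomorphic_on_subset[OF inv]]) (auto simp: 3 F split: if_splits)
  next
    case 4
    have "(\<lambda>z. 1 / h (1 / z)) holomorphic_on {z. (z \<noteq> 0 \<and> 1 / z \<in> U) \<and> h (1 / z) \<noteq> 0}"
      by (intro holomorphic_intros holomorphic_on_subset[OF inv]) auto
    then show ?thesis
      by (rule holomorphic_transform[OF holomorphic_on_subset]) (auto simp: 4 F split: if_splits)
  qed
qed

lemma sphere_holomorphic_on_finite_chart:
  assumes "sphere_holomorphic_on F V"
  shows "(\<lambda>z. the (F (Some z))) holomorphic_on {z. Some z \<in> V \<and> F (Some z) \<noteq> None}"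
proof -
  have "(\<lambda>z. the (id (F (id (Some z))))) holomorphic_on {z. id (Some z) \<in> V \<and> id (F (id (Some z))) \<noteq> None}"
    using assms unfolding sphere_holomorphic_on_def by blast
  then show ?thesis by simp
qed

lemma chordal_Some_le: "chordal (Some z) (Some w) \<le> 2 * dist z w"
proof -
  have "1 \<le> sqrt (1 + (cmod z)\<^sup>2) * sqrt (1 + (cmod w)\<^sup>2)"
    using mult_mono[of 1 "sqrt (1 + (cmod z)\<^sup>2)" 1 "sqrt (1 + (cmod w)\<^sup>2)"] by simp
  then have "2 * cmod (z - w) / (sqrt (1 + (cmod z)\<^sup>2) * sqrt (1 + (cmod w)\<^sup>2)) \<le> 2 * cmod (z - w) / 1"
    by (intro divide_left_mono) auto
  then show ?thesis by (simp add: dist_norm)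
qed

lemma compactin_sphere_Some:
  assumes "compactin sphere_top (Some ` K)" shows "compact K"
proof -
  have "Hausdorff_space sphere_top"
    by (simp add: Hausdorff_space_Alexandroff_compactification locally_compact_space_euclidean)
  from compactin_imp_closedin[OF this assms] show ?thesis by simp
qed

text \<open>
  This is Montel's theorem, the chordal metric being at most twice the Euclidean one.
\<close>

lemma normal_family_on_bounded_holomorphic:
  assumes "open U" and fam: "\<And>f. f \<in> F \<Longrightarrow> \<exists>h. h holomorphic_on U \<and>
       (\<forall>z\<in>U. f (Some z) = Some (h z) \<and> cmod (h z) \<le> M)"
  shows "normal_family_on F (Some ` U)"
  unfolding normal_family_on_def
proof (intro allI impI)
  fix s :: "nat \<Rightarrow> sphere \<Rightarrow> sphere" assume "range s \<subseteq> F"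
  then have "\<exists>h. h holomorphic_on U \<and> (\<forall>z\<in>U. s n (Some z) = Some (h z) \<and> cmod (h z) \<le> M)" for n
    using fam by blast
  then obtain h where h: "\<And>n. h n holomorphic_on U"
    "\<And>n z. z \<in> U \<Longrightarrow> s n (Some z) = Some (h n z)" "\<And>n z. z \<in> U \<Longrightarrow> cmod (h n z) \<le> M"
    by metis
  obtain g r where r: "strict_mono (r :: nat \<Rightarrow> nat)"
    and lim: "\<And>K. compact K \<Longrightarrow> K \<subseteq> U \<Longrightarrow> uniform_limit K (h \<circ> r) g sequentially"
  proof (rule Montel[OF \<open>open U\<close>, of "range h" h])
    show "\<exists>B. \<forall>k\<in>range h. \<forall>z\<in>K. cmod (k z) \<le> B" if "K \<subseteq> U" for K
      using h(3) that by blast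
  qed (use h(1) in auto)
  show "\<exists>(r :: nat \<Rightarrow> nat) g. strict_mono r \<and>
          (\<forall>K. compactin sphere_top K \<and> K \<subseteq> Some ` U \<longrightarrow>
             (\<forall>e>0. \<exists>N. \<forall>n\<ge>N. \<forall>x\<in>K. chordal (s (r n) x) (g x) < e))"
  proof (intro exI[of _ r] exI[of _ "\<lambda>x. Some (g (the x))"] conjI r allI impI)
    fix K and e :: real
    assume "compactin sphere_top K \<and> K \<subseteq> Some ` U" "e > 0"
    then obtain K' where K': "K = Some ` K'" "K' \<subseteq> U" "compact K'"
      using compactin_sphere_Some by (metis subset_imageE)
    have "\<forall>\<^sub>F n in sequentially. \<forall>x\<in>K'. dist ((h \<circ> r) n x) (g x) < e / 2"
      using uniform_limitD[OF lim[OF K'(3,2)], of "e / 2"] \<open>e > 0\<close> by simp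
    then obtain N where N: "\<And>n x. n \<ge> N \<Longrightarrow> x \<in> K' \<Longrightarrow> dist (h (r n) x) (g x) < e / 2"
      unfolding eventually_sequentially by auto
    have "chordal (s (r n) (Some x)) (Some (g x)) < e" if "n \<ge> N" "x \<in> K'" for n x
    proof -
      have "chordal (s (r n) (Some x)) (Some (g x)) = chordal (Some (h (r n) x)) (Some (g x))"
        using h(2) K'(2) that by (simp add: subsetD)
      also have "\<dots> \<le> 2 * dist (h (r n) x) (g x)" by (rule chordal_Some_le)
      also have "\<dots> < e" using N[OF that] by simp
      finally show ?thesis .
    qed
    then show "\<exists>N. \<forall>n\<ge>N. \<forall>x\<in>K. chordal (s (r n) x) (Some (g (the x))) < e"
      using K'(1) by auto
  qed
qed

section \<open>The Fatou set of the tangent family\<close>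

lemma iterate_0 [simp]: "iterate f 0 x = x"
  and iterate_Suc: "iterate f (Suc n) x = Option.bind (iterate f n x) f"
  by (simp_all add: iterate_def)

text \<open>
  Up to the first pole on an orbit, iterating on the sphere amounts to iterating the total function
  \<open>l * tan z\<close>, so that from here on all orbits can be computed in the plane.
\<close>

lemma iterate_tan_map:
  assumes "\<And>k. k < n \<Longrightarrow> cos (((\<lambda>z. l * tan z) ^^ k) z) \<noteq> 0"
  shows "iterate (tan_map l) n (Some z) = Some (((\<lambda>z. l * tan z) ^^ n) z)"
  using assms by (induction n) (simp_all add: iterate_Suc tan_map_def)

lemma iterate_dom_cos:
  assumes "\<And>n. Some z \<in> iterate_dom (tan_map l) n"
  shows "cos (((\<lambda>z. l * tan z) ^^ k) z) \<noteq> 0"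
proof (induction k rule: less_induct)
  case (less k)
  have "iterate (tan_map l) (Suc k) (Some z) \<noteq> None"
    using assms[of "Suc (Suc k)"] by (auto simp: iterate_dom_def)
  then show ?case
    using iterate_tan_map[OF less] by (auto simp: iterate_Suc tan_map_def)
qed

lemma holomorphic_tan_iterates:
  assumes "\<And>z n. z \<in> U \<Longrightarrow> cos (((\<lambda>z. l * tan z) ^^ n) z) \<noteq> 0"
  shows "((\<lambda>z. l * tan z) ^^ n) holomorphic_on U"
proof (induction n)
  case 0 then show ?case by (simp add: id_def)
next
  case (Suc n)
  have "(tan \<circ> (\<lambda>z. l * tan z) ^^ n) holomorphic_on U"
    using assms by (intro holomorphic_on_compose[OF Suc holomorphic_on_tan]) auto
  then show ?case by (auto intro!: holomorphic_intros simp: o_def)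
qed

lemma bounded_orbits_subset_Fatou:
  assumes "open U" and np: "\<And>z n. z \<in> U \<Longrightarrow> cos (((\<lambda>z. l * tan z) ^^ n) z) \<noteq> 0"
    and bd: "\<And>z n. z \<in> U \<Longrightarrow> cmod (((\<lambda>z. l * tan z) ^^ n) z) \<le> M"
  shows "Some ` U \<subseteq> Fatou (tan_map l)"
proof
  fix x assume x: "x \<in> Some ` U"
  note it = iterate_tan_map[OF np]
  note hol = holomorphic_tan_iterates[OF np, of U]
  have dom: "Some ` U \<subseteq> iterate_dom (tan_map l) n" for n
    using it by (auto simp: iterate_dom_def)
  have op: "openin sphere_top (Some ` U)" using \<open>open U\<close> by simp
  have "sphere_holomorphic_on (iterate (tan_map l) n) (Some ` U)" for n
    by (rule sphere_holomorphic_on_SomeI[OF \<open>open U\<close> hol it])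
  moreover have "\<forall>y\<in>Some ` U. iterate (tan_map l) n y \<noteq> None" for n using it by auto
  ultimately have mer: "sphere_meromorphic_on (iterate (tan_map l) n) (Some ` U)" for n
    unfolding sphere_meromorphic_on_def using op by blast
  have "normal_family_on (range (iterate (tan_map l))) (Some ` U)"
  proof (rule normal_family_on_bounded_holomorphic[OF \<open>open U\<close>])
    fix f assume "f \<in> range (iterate (tan_map l))"
    then obtain n where f: "f = iterate (tan_map l) n" by (rule rangeE)
    show "\<exists>h. h holomorphic_on U \<and> (\<forall>z\<in>U. f (Some z) = Some (h z) \<and> cmod (h z) \<le> M)"
      unfolding f by (intro exI[of _ "(\<lambda>z. l * tan z) ^^ n"] conjI ballI hol it bd)
  qed
  then show "x \<in> Fatou (tan_map l)"
    unfolding Fatou_def mem_Collect_eq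
    by (intro exI[of _ "Some ` U"] conjI allI x op dom mer)
qed

lemma Fatou_iterate_dom: "x \<in> Fatou f \<Longrightarrow> x \<in> iterate_dom f n"
  unfolding Fatou_def by blast

lemma None_notin_Fatou: "None \<notin> Fatou f"
  using Fatou_iterate_dom[of None f 1] by (auto simp: iterate_dom_def)

section \<open>Herman rings\<close>

text \<open>
  Here \<open>ph\<close> stands for the uniformization of an annulus \<open>V\<close> and \<open>g\<close> for a core curve.  If \<open>g\<close> surrounded
  only points of \<open>V\<close>, the integral of \<open>ph' / ph\<close> along \<open>g\<close> would vanish, whereas \<open>ph\<close> takes \<open>g\<close> to a
  circle about \<open>0\<close>.
\<close>

lemma core_curve_surrounds_hole:
  assumes "open V" and hol: "ph holomorphic_on V" and nz: "\<And>z. z \<in> V \<Longrightarrow> ph z \<noteq> 0"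
    and g: "valid_path g" "pathfinish g = pathstart g" "path_image g \<subseteq> V"
    and circle: "ph \<circ> g = circlepath 0 r" and "r > 0"
  shows "\<not> inside (path_image g) \<subseteq> V"
proof
  assume ins: "inside (path_image g) \<subseteq> V"
  have "((\<lambda>z. deriv ph z * (1 / ph z)) has_contour_integral 0) g"
  proof (rule Cauchy_theorem_global_outside[OF \<open>open V\<close> _ g])
    show "(\<lambda>z. deriv ph z * (1 / ph z)) holomorphic_on V"
      using nz by (intro holomorphic_intros hol \<open>open V\<close>) auto
    show "w \<in> outside (path_image g)" if "w \<notin> V" for w
      using that ins g(3) unfolding outside_inside by blast
  qed
  then have "0 = contour_integral g (\<lambda>z. deriv ph z * (1 / ph z))"
    by (simp add: contour_integral_unique)
  also have "\<dots> = contour_integral (ph \<circ> g) (\<lambda>w. 1 / w)"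
    using hol \<open>open V\<close> g
    by (intro contour_integral_comp_analyticW[symmetric, of _ V]) (auto simp: analytic_on_open)
  also have "\<dots> = 2 * pi * \<i>"
    unfolding circle using contour_integral_circlepath[of r 0] \<open>r > 0\<close> by simp
  finally show False by simp
qed

lemma circlepath_shift: "circlepath 0 r (t + a) = cis (2 * pi * a) * circlepath 0 r t"
  by (simp add: circlepath cis_conv_exp mult_exp_exp algebra_simps)

theorem proposition5p9:
  fixes l :: complex
  assumes "l \<noteq> 0"
  shows "\<not> (\<exists>p D. Herman_ring_cycle (tan_map l) p D)"
proof
  assume "\<exists>p D. Herman_ring_cycle (tan_map l) p D"
  then obtain p D where H: "Herman_ring_cycle (tan_map l) p D" by blast
  define f where "f = tan_map l"
  define G where "G = (\<lambda>n. (\<lambda>z. l * tan z) ^^ n)"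
  note H = H[unfolded Herman_ring_cycle_def, folded f_def]
  have p: "p \<ge> 1" using H by (rule conjunct1)
  have comp: "\<forall>i<p. D i \<in> Fatou_components f \<and> iterate f 1 ` D i \<subseteq> D (Suc i mod p)"
    using H by (elim conjE) assumption
  have D0: "D 0 \<in> Fatou_components f"
    and cyc: "\<And>i. i < p \<Longrightarrow> iterate f 1 ` D i \<subseteq> D (Suc i mod p)"
    using comp p by simp_all
  have "\<forall>i<p. \<exists>(R::real) \<phi> (\<theta>::real). R > 1 \<and> \<theta> \<notin> \<rat> \<and>
        biholomorphic_onto \<phi> (D i) (std_annulus R) \<and>
        (\<forall>x\<in>D i. \<phi> (iterate f p x) = cis (2 * pi * \<theta>) * \<phi> x)"
    using H by (elim conjE) assumption
  from this[rule_format, of 0] obtain R \<phi> \<theta> where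
    R: "(R::real) > 1" and irr: "(\<theta>::real) \<notin> \<rat>"
    and bih: "biholomorphic_onto \<phi> (D 0) (std_annulus R)"
    and conj: "\<And>x. x \<in> D 0 \<Longrightarrow> \<phi> (iterate f p x) = cis (2 * pi * \<theta>) * \<phi> x"
    using p by auto
  \<comment> \<open>The ring is a plane domain \<open>V\<close>, with uniformization \<open>ph\<close> and inverse \<open>ps\<close>.\<close>
  define V where "V = {z. Some z \<in> D 0}"
  have DF: "D 0 \<subseteq> Fatou f"
    using connected_components_of_subset[OF D0[unfolded Fatou_components_def]] by simp
  then have DV: "D 0 = Some ` V"
  proof (intro set_eqI iffI)
    fix x assume x: "x \<in> D 0"
    then obtain z where "x = Some z" using DF None_notin_Fatou by (cases x) auto
    with x show "x \<in> Some ` V" by (simp add: V_def)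
  qed (auto simp: V_def)
  have hol1: "sphere_holomorphic_on (Some \<circ> \<phi>) (D 0)"
    and hol2: "sphere_holomorphic_on (inv_into (D 0) \<phi> \<circ> the) (Some ` std_annulus R)"
    and bij: "bij_betw \<phi> (D 0) (std_annulus R)"
    using bih by (auto simp: biholomorphic_onto_def)
  have opV: "open V"
    using hol1 open_Some_vimage unfolding V_def sphere_holomorphic_on_def by blast
  define ph where "ph = (\<lambda>z. \<phi> (Some z))"
  define ps where "ps = (\<lambda>u. the (inv_into (D 0) \<phi> u))"
  have Some_ps: "Some (ps u) = inv_into (D 0) \<phi> u" "inv_into (D 0) \<phi> u \<in> D 0"
    if "u \<in> std_annulus R" for u
    using bij_betw_apply[OF bij_betw_inv_into[OF bij] that] DV by (auto simp: ps_def)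
  have psV: "ps u \<in> V" if "u \<in> std_annulus R" for u
    using Some_ps[OF that] by (simp add: V_def)
  have ph_ps: "ph (ps u) = u" if "u \<in> std_annulus R" for u
    using bij_betw_inv_into_right[OF bij that] Some_ps[OF that] by (simp add: ph_def)
  have phA: "ph z \<in> std_annulus R" if "z \<in> V" for z
    using bij_betw_apply[OF bij] that by (simp add: ph_def V_def)
  have ph_inj: "z = w" if "ph z = ph w" "z \<in> V" "w \<in> V" for z w
    using bij_betw_imp_inj_on[OF bij] that by (auto simp: ph_def V_def inj_on_def)
  have holph: "ph holomorphic_on V"
    using sphere_holomorphic_on_finite_chart[OF hol1] by (simp add: ph_def V_def)
  have holps: "ps holomorphic_on std_annulus R"
    by (rule holomorphic_on_subset[OF sphere_holomorphic_on_finite_chart[OF hol2, unfolded comp_def option.sel, folded ps_def]])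
      (auto simp: Some_ps(1)[symmetric])
  have np: "cos (G k z) \<noteq> 0" if "z \<in> V" for k z
    unfolding G_def using that DF Fatou_iterate_dom
    by (intro iterate_dom_cos) (auto simp: V_def f_def)
  have itG: "iterate f n (Some z) = Some (G n z)" if "z \<in> V" for n z
    unfolding f_def G_def using np[OF that] by (intro iterate_tan_map) (simp add: G_def)
  have holG: "G n holomorphic_on V" for n
    unfolding G_def using np by (intro holomorphic_tan_iterates) (simp add: G_def)
  have cycle: "Some (G n z) \<in> D (n mod p)" if "z \<in> V" for n z
  proof (induction n)
    case (Suc n)
    have "iterate f 1 (Some (G n z)) = Some (G (Suc n) z)"
      using itG[OF that, of "Suc n"] itG[OF that, of n] by (simp add: iterate_Suc)
    moreover have "iterate f 1 (Some (G n z)) \<in> D (Suc (n mod p) mod p)"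
      using cyc[of "n mod p"] Suc p by (simp add: image_subset_iff)
    ultimately show ?case by (simp add: mod_Suc_eq)
  qed (use that in \<open>simp add: G_def V_def\<close>)
  have ret: "G p z \<in> V" "ph (G p z) = cis (2 * pi * \<theta>) * ph z" if "z \<in> V" for z
  proof -
    show "G p z \<in> V" using cycle[OF that, of p] by (simp add: V_def)
    show "ph (G p z) = cis (2 * pi * \<theta>) * ph z"
      using conj[of "Some z"] itG[OF that, of p] that by (simp add: ph_def V_def)
  qed
  have G_add: "G (m + n) z = G m (G n z)" for m n z by (simp add: G_def funpow_add)
  \<comment> \<open>Every iterate is injective on the ring, since some further iterate is a rotation.\<close>
  have G_inj: "z = w" if "G k z = G k w" "z \<in> V" "w \<in> V" for k z w
  proof -
    have "ph (G (n * p) z) = cis (2 * pi * \<theta>) ^ n * ph z \<and> G (n * p) z \<in> V" if "z \<in> V" for n z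
    proof (induction n)
      case (Suc n)
      then show ?case using ret[of "G (n * p) z"] by (simp add: G_add mult.assoc)
    qed (use that in \<open>simp add: G_def\<close>)
    moreover have "G (k * p) z = G (k * p) w"
    proof -
      have "k * p = (k * p - k) + k" using p by simp
      then show ?thesis using G_add[of "k * p - k" k] that(1) by metis
    qed
    ultimately have "cis (2 * pi * \<theta>) ^ k * ph z = cis (2 * pi * \<theta>) ^ k * ph w"
      using that by metis
    then show ?thesis using ph_inj that by simp
  qed
  \<comment> \<open>Any radius strictly between \<open>1\<close> and \<open>R\<close> gives an invariant curve.\<close>
  define r where "r = (1 + R) / 2"
  define c where "c = (\<lambda>k. (G k \<circ> ps) \<circ> circlepath 0 r)"
  have r: "1 < r" "r < R" using R by (auto simp: r_def)
  have circ: "circlepath 0 r t \<in> std_annulus R" for t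
    using r by (simp add: circlepath std_annulus_def norm_mult)
  have circ_img: "path_image (circlepath 0 r) \<subseteq> std_annulus R"
    using circ by (auto simp: path_image_def)
  have opA: "open (std_annulus R)" unfolding std_annulus_def
    by (intro open_Collect_conj open_Collect_less continuous_intros)
  have holGps: "(G k \<circ> ps) holomorphic_on std_annulus R" for k
    using psV by (intro holomorphic_on_compose_gen[OF holps holG]) auto
  have c_rot: "G p (ps (circlepath 0 r t)) = ps (circlepath 0 r (t + \<theta>))" for t
  proof (rule ph_inj)
    have "ph (G p (ps (circlepath 0 r t))) = cis (2 * pi * \<theta>) * circlepath 0 r t"
      using ret(2)[OF psV[OF circ], of t] by (simp only: ph_ps[OF circ])
    also have "\<dots> = circlepath 0 r (t + \<theta>)" by (rule circlepath_shift[symmetric])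
    also have "\<dots> = ph (ps (circlepath 0 r (t + \<theta>)))" by (rule ph_ps[OF circ, symmetric])
    finally show "ph (G p (ps (circlepath 0 r t))) = ph (ps (circlepath 0 r (t + \<theta>)))" .
  qed (rule ret(1) psV circ)+
  interpret rotating_tan_curves l \<theta> p c
  proof
    show valid: "valid_path (c k)" for k
      unfolding c_def by (intro valid_path_compose_holomorphic[OF _ holGps opA circ_img]) simp
    show "simple_path (c k)" for k
      unfolding simple_path_def
    proof
      show "path (c k)" by (rule valid_path_imp_path[OF valid])
      have "circlepath 0 r x = circlepath 0 r y" if "c k x = c k y" for x y
        using that G_inj[of k, OF _ psV psV] ph_ps circ unfolding c_def comp_def by metis
      moreover have "loop_free (circlepath 0 r)"
        using simple_path_circlepath[of 0 r] r by (simp add: simple_path_def)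
      ultimately show "loop_free (c k)" unfolding loop_free_def by blast
    qed
    show "continuous_on UNIV (c k)" for k
      unfolding c_def
    proof (rule continuous_on_compose)
      show "continuous_on UNIV (circlepath 0 r)"
        unfolding circlepath by (intro continuous_intros)
      show "continuous_on (circlepath 0 r ` UNIV) (G k \<circ> ps)"
        by (rule continuous_on_subset[OF holomorphic_on_imp_continuous_on[OF holGps]]) (use circ in blast)
    qed
    show "c k (t + 1) = c k t" for k t using circlepath_shift[of r t 1] by (simp add: c_def)
    show "cos (c k t) \<noteq> 0" for k t using np psV circ by (simp add: c_def)
    show "c (Suc k) t = l * tan (c k t)" for k t by (simp add: c_def G_def)
    show "c (k + p) t = c k (t + \<theta>)" for k t using c_rot by (simp add: c_def G_add)
  qed (use assms irr p in auto)
  define C B where "C = path_image (c 0)" and "B = inside C"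
  have J: "open B" "connected B" "frontier B = C" "B \<noteq> {}"
    using Jordan_inside_outside[OF simple[of 0] loop] by (simp_all add: B_def C_def)
  obtain M where M: "\<And>z n. z \<in> B \<Longrightarrow> cos (G n z) \<noteq> 0 \<and> cmod (G n z) \<le> M"
    using bounded_orbits_inside unfolding G_def B_def C_def by blast
  \<comment> \<open>The filled curve is connected, lies in the Fatou set and meets the component \<open>D 0\<close>.\<close>
  have "Some ` B \<subseteq> Fatou f"
    unfolding f_def using M by (intro bounded_orbits_subset_Fatou[OF J(1), of _ M]) (auto simp: G_def)
  moreover have "C \<subseteq> V"
    using psV circ by (auto simp: C_def path_image_def c_def G_def)
  moreover have clB: "closure B = B \<union> C"
    using J closure_Un_frontier by blast
  ultimately have "Some ` closure B \<subseteq> Fatou f" using DF DV by blast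
  moreover have "connectedin sphere_top (Some ` closure B)"
    using connectedin_continuous_map_image[OF continuous_map_Some, of euclidean "closure B"] J(2)
    by (simp add: connected_imp_connected_closure)
  ultimately have "connectedin (subtopology sphere_top (Fatou f)) (Some ` closure B)"
    by (simp add: connectedin_subtopology)
  moreover have "\<not> disjnt (D 0) (Some ` closure B)"
  proof -
    have "c 0 0 \<in> C" by (auto simp: C_def path_image_def)
    then show ?thesis using \<open>C \<subseteq> V\<close> clB DV unfolding disjnt_def by blast
  qed
  ultimately have "Some ` closure B \<subseteq> D 0"
    using connected_components_of_maximal D0 unfolding Fatou_components_def by blast
  then have filled: "B \<union> C \<subseteq> V" using clB DV by blast
  have ph0: "ph z \<noteq> 0" if "z \<in> V" for z
    using phA[OF that] by (auto simp: std_annulus_def)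
  have "ph \<circ> c 0 = circlepath 0 r"
    using ph_ps circ by (auto simp: c_def G_def)
  from core_curve_surrounds_hole[OF opV holph ph0 valid loop _ this]
  show False using filled r by (simp add: B_def C_def)
qed

end
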